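(* Let $n\ge 2$ be an integer, let $A,B,C,D$ be the blocks and $R_3(n)$ the region defined in the context. Then: (i) no unit cube location (location label) belongs to two different blocks among $A,B,C,D$; i.e. the blocks intersect at most trivially, along common boundary faces of adjacent unit cubes; (ii) every unit cube sized location of $R_3(n)$ is occupied by a unit cube of $A\cup B\cup C\cup D$, except for the locations with labels in the set $V=\{(i+1,1,z,w): 1\le i\le n,\ z,w\in\{1,\dots,i\}\}$ (located at $y=1$), which are unoccupied; $V$ has $1^2+2^2+\cdots+n^2$ elements, and for each $(x,1,z,w)\in V$ the unit cube with label $(x,2,z,w)$ belongs to $C$ (and conversely each unit cube of $C$ with $y=2$ is adjacent in this way to a location in $V$); (iii) every unit cube of $A\cup B\cup C\cup D$ lies in $R_3(n)$ except for the unit cubes of $D$ whose label has $z=0$; these form an overhang layer of $1^2+2^2+\cdots+n^2$ unit cubes lying outside $R_3(n)$.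
   Context: Coordinates on $\mathbb{R}^4$ are $(x,y,z,w)$. For integers $a,b,c,d$, the unit cube (or unit cube sized location) with location label $(a,b,c,d)$ is the set $\{(x,y,z,w): a-1\le x\le a,\ b-1\le y\le b,\ c-1\le z\le c,\ d-1\le w\le d\}$. For a fixed integer $n\ge 2$, the blocks are the unions of the unit cubes with labels in the following sets: $A=\{(x,y,z,w): 1\le i\le n,\ z=i,\ x,y,w\in\{1,\dots,i\}\}$; $B=\{(x,y,z,w): 1\le i\le n,\ y=i+1,\ x,z,w\in\{1,\dots,i\}\}$; $C=\{(x,y,z,w): 1\le i\le n,\ x=i+1,\ y\in\{2,\dots,i+1\},\ z,w\in\{1,\dots,i\}\}$; $D=\{(x,y,z,w): 1\le i\le n,\ w=i,\ x,y\in\{1,\dots,i\},\ z\in\{0,\dots,i-1\}\}$. The region $R_3(n)$ is the union of the unit cube sized locations with labels $(x,y,z,w)$ satisfying $x,y\in\{1,\dots,n+1\}$ and $z,w\in\{1,\dots,n\}$; its volume is $n^2(n+1)^2$. *)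

theory Defs
  imports "HOL-Analysis.Analysis"
begin

text \<open>Location labels are integer quadruples \<open>(x, y, z, w)\<close>; the components of a point
  \<open>v :: real ^ 4\<close> are, in this order, its \<open>x\<close>, \<open>y\<close>, \<open>z\<close> and \<open>w\<close> coordinates.\<close>

type_synonym label = "int \<times> int \<times> int \<times> int"

definition unit_cube :: "label \<Rightarrow> (real ^ 4) set" where
  "unit_cube = (\<lambda>(a, b, c, d). {v.
     of_int a - 1 \<le> v $ 1 \<and> v $ 1 \<le> of_int a \<and>
     of_int b - 1 \<le> v $ 2 \<and> v $ 2 \<le> of_int b \<and>
     of_int c - 1 \<le> v $ 3 \<and> v $ 3 \<le> of_int c \<and>
     of_int d - 1 \<le> v $ 4 \<and> v $ 4 \<le> of_int d})"

definition cubes_union :: "label set \<Rightarrow> (real ^ 4) set" where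
  "cubes_union L = (\<Union>p\<in>L. unit_cube p)"

datatype block_name = BlockA | BlockB | BlockC | BlockD

fun labels :: "int \<Rightarrow> block_name \<Rightarrow> label set" where
  "labels n BlockA = {(x, y, z, w). \<exists>i\<in>{1..n}.
     z = i \<and> x \<in> {1..i} \<and> y \<in> {1..i} \<and> w \<in> {1..i}}"
| "labels n BlockB = {(x, y, z, w). \<exists>i\<in>{1..n}.
     y = i + 1 \<and> x \<in> {1..i} \<and> z \<in> {1..i} \<and> w \<in> {1..i}}"
| "labels n BlockC = {(x, y, z, w). \<exists>i\<in>{1..n}.
     x = i + 1 \<and> y \<in> {2..i + 1} \<and> z \<in> {1..i} \<and> w \<in> {1..i}}"
| "labels n BlockD = {(x, y, z, w). \<exists>i\<in>{1..n}.
     w = i \<and> x \<in> {1..i} \<and> y \<in> {1..i} \<and> z \<in> {0..i - 1}}"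

definition block :: "int \<Rightarrow> block_name \<Rightarrow> (real ^ 4) set" where
  "block n X = cubes_union (labels n X)"

definition R3_labels :: "int \<Rightarrow> label set" where
  "R3_labels n = {(x, y, z, w).
     x \<in> {1..n + 1} \<and> y \<in> {1..n + 1} \<and> z \<in> {1..n} \<and> w \<in> {1..n}}"

definition R3 :: "int \<Rightarrow> (real ^ 4) set" where
  "R3 n = cubes_union (R3_labels n)"

definition V_labels :: "int \<Rightarrow> label set" where
  "V_labels n = {(i + 1, 1, z, w) | i z w. i \<in> {1..n} \<and> z \<in> {1..i} \<and> w \<in> {1..i}}"

definition overhang_labels :: "int \<Rightarrow> label set" where
  "overhang_labels n = {(x, y, z, w). (x, y, z, w) \<in> labels n BlockD \<and> z = 0}"

end

theory Submission
  imports Defs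
begin

text \<open>The four label sets separate the quadruples according to which coordinate is largest, ties being
  broken in a fixed way, so the statements about labels are linear integer arithmetic.
  Geometrically, the interior of a unit cube misses every other unit cube, and if a proper convex
  combination of two points of a cube has an extreme coordinate, then so do both points; hence two
  unit cubes meet in a common face.\<close>

text \<open>The vertex with the largest coordinates, kept as a vector so that a cube becomes a
  \<open>cbox\<close> and all four coordinates are treated uniformly.\<close>

definition corner :: "label \<Rightarrow> real ^ 4" where
  "corner = (\<lambda>(a, b, c, d). \<chi> j. of_int (if j = 1 then a else if j = 2 then b else if j = 3 then c else d))"

lemma corner_nth:
  "corner (a, b, c, d) $ 1 = of_int a" "corner (a, b, c, d) $ 2 = of_int b"
  "corner (a, b, c, d) $ 3 = of_int c" "corner (a, b, c, d) $ 4 = of_int d"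
  by (simp_all add: corner_def)

lemma corner_nth_int: "\<exists>m. corner p $ j = of_int m"
  by (cases p) (auto simp: corner_def)

lemma corner_eq_iff: "corner p = corner q \<longleftrightarrow> p = q"
  by (cases p; cases q) (auto simp: vec_eq_iff forall_4 corner_nth)

lemma unit_cube_eq_cbox: "unit_cube p = cbox (corner p - 1) (corner p)"
  by (cases p) (auto simp: unit_cube_def mem_box_cart forall_4 corner_nth)

lemma mem_unit_cube: "v \<in> unit_cube p \<longleftrightarrow> (\<forall>j. corner p $ j - 1 \<le> v $ j \<and> v $ j \<le> corner p $ j)"
  by (simp add: unit_cube_eq_cbox mem_box_cart)

lemma interior_unit_cube: "interior (unit_cube p) = box (corner p - 1) (corner p)"
  by (simp add: unit_cube_eq_cbox)

lemma mem_interior_unit_cube: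
  "v \<in> interior (unit_cube p) \<longleftrightarrow> (\<forall>j. corner p $ j - 1 < v $ j \<and> v $ j < corner p $ j)"
  by (simp add: interior_unit_cube mem_box_cart)

text \<open>Lets disjointness from the open cube be carried over to the closed cube.\<close>

lemma unit_cube_subset_closure_interior: "unit_cube p \<subseteq> closure (interior (unit_cube p))"
proof -
  have "box (corner p - 1) (corner p) \<noteq> {}"
    by (simp add: interval_ne_empty_cart)
  then show ?thesis
    by (simp add: unit_cube_eq_cbox)
qed

text \<open>In each coordinate, \<open>k - 1 < v < k\<close> and
  \<open>l - 1 \<le> v \<le> l\<close> with integers \<open>k\<close>, \<open>l\<close> force
  \<open>k = l\<close>, so the corners coincide.\<close>

lemma interior_unit_cube_Int_unit_cube:
  assumes "p \<noteq> q"
  shows "interior (unit_cube p) \<inter> unit_cube q = {}"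
proof -
  have "p = q" if v: "v \<in> interior (unit_cube p)" "v \<in> unit_cube q" for v
  proof -
    have "corner p $ j = corner q $ j" for j
    proof -
      obtain k l where kl: "corner p $ j = of_int k" "corner q $ j = of_int l"
        using corner_nth_int by metis
      have "of_int k - 1 < v $ j" "v $ j < of_int k" "of_int l - 1 \<le> v $ j" "v $ j \<le> of_int l"
        using v by (simp_all add: mem_interior_unit_cube mem_unit_cube flip: kl)
      then have "k = l" by linarith
      with kl show ?thesis by simp
    qed
    then show ?thesis by (simp add: vec_eq_iff flip: corner_eq_iff)
  qed
  with assms show ?thesis by blast
qed

lemma interior_unit_cube_Int_cubes_union:
  assumes "p \<notin> L"
  shows "interior (unit_cube p) \<inter> cubes_union L = {}"
proof -
  have "interior (unit_cube p) \<inter> unit_cube q = {}" if "q \<in> L" for q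
    using that assms by (intro interior_unit_cube_Int_unit_cube) blast
  then show ?thesis unfolding cubes_union_def by blast
qed

lemma cubes_union_Int_interior:
  assumes "L \<inter> M = {}"
  shows "cubes_union L \<inter> interior (cubes_union M) = {}"
proof -
  have "unit_cube p \<inter> interior (cubes_union M) = {}" if "p \<in> L" for p
  proof -
    have "interior (unit_cube p) \<inter> interior (cubes_union M) = {}"
      using that assms interior_unit_cube_Int_cubes_union[of p M] interior_subset[of "cubes_union M"]
      by blast
    \<comment> \<open>An open set that misses a set also misses its closure.\<close>
    then have "interior (cubes_union M) \<inter> closure (interior (unit_cube p)) = {}"
      by (subst open_Int_closure_eq_empty) (auto simp: Int_commute)
    then show ?thesis using unit_cube_subset_closure_interior by blast
  qed
  then show ?thesis unfolding cubes_union_def[of L] by blast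
qed

text \<open>This is the trivial intersection of (i): a common point lies in the closures of both
  unions but in the interior of neither.\<close>

lemma cubes_union_Int_subset_frontier:
  assumes "L \<inter> M = {}"
  shows "cubes_union L \<inter> cubes_union M \<subseteq> frontier (cubes_union L) \<inter> frontier (cubes_union M)"
proof -
  have "cubes_union L \<inter> interior (cubes_union M) = {}" "cubes_union M \<inter> interior (cubes_union L) = {}"
    using assms by (auto intro!: cubes_union_Int_interior simp: Int_commute)
  then show ?thesis
    using closure_subset unfolding frontier_def by blast
qed

text \<open>One coordinate of the face property. If \<open>l \<noteq> k\<close>, the two unit
  intervals share at most an endpoint, and a proper convex combination reaches an endpoint only when
  both \<open>u\<close> and \<open>v\<close> equal it.\<close>

lemma segment_endpoints_in_unit_interval:
  fixes k l :: int and u v t :: real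
  assumes u: "of_int k - 1 \<le> u" "u \<le> of_int k" and v: "of_int k - 1 \<le> v" "v \<le> of_int k"
    and t: "0 < t" "t < 1"
    and x: "of_int l - 1 \<le> (1 - t) * u + t * v" "(1 - t) * u + t * v \<le> of_int l"
  shows "of_int l - 1 \<le> u \<and> u \<le> of_int l \<and> of_int l - 1 \<le> v \<and> v \<le> of_int l"
proof -
  \<comment> \<open>\<open>\<alpha> + \<beta>\<close> is the distance of the combination from the
    upper end \<open>k\<close>, and \<open>\<gamma> + \<delta>\<close> that from the lower end
    \<open>k - 1\<close>. Once such a sum vanishes, so do its nonnegative terms, and the positive
    weights cancel.\<close>
  define \<alpha> \<beta> where "\<alpha> = (1 - t) * (of_int k - u)" and "\<beta> = t * (of_int k - v)"
  define \<gamma> \<delta> where "\<gamma> = (1 - t) * (u - (of_int k - 1))" and "\<delta> = t * (v - (of_int k - 1))"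
  have nonneg: "\<alpha> \<ge> 0" "\<beta> \<ge> 0" "\<gamma> \<ge> 0" "\<delta> \<ge> 0"
    using u v t by (simp_all add: \<alpha>_def \<beta>_def \<gamma>_def \<delta>_def)
  have top: "(1 - t) * u + t * v = of_int k - \<alpha> - \<beta>"
    by (simp add: \<alpha>_def \<beta>_def algebra_simps)
  have bot: "(1 - t) * u + t * v = of_int k - 1 + \<gamma> + \<delta>"
    by (simp add: \<gamma>_def \<delta>_def algebra_simps)
  consider "l = k" | "l \<ge> k + 1" | "l \<le> k - 1" by linarith
  then show ?thesis
  proof cases
    case 1
    with u v show ?thesis by simp
  next
    case 2
    then have "\<alpha> = 0" "\<beta> = 0" "l = k + 1"
      using nonneg top x by linarith+
    with t show ?thesis by (simp add: \<alpha>_def \<beta>_def)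
  next
    case 3
    then have "\<gamma> = 0" "\<delta> = 0" "l = k - 1"
      using nonneg bot x by linarith+
    with t show ?thesis by (simp add: \<gamma>_def \<delta>_def)
  qed
qed

text \<open>Points of an open segment are combinations with \<open>0 < t < 1\<close>, so the
  one-dimensional lemma applies in every coordinate. Disjoint cubes are included, the empty set
  being a face.\<close>

lemma unit_cube_Int_face_of: "(unit_cube p \<inter> unit_cube q) face_of unit_cube p"
  unfolding face_of_def
proof (intro conjI ballI impI)
  show "unit_cube p \<inter> unit_cube q \<subseteq> unit_cube p" by blast
  show "convex (unit_cube p \<inter> unit_cube q)"
    by (simp add: unit_cube_eq_cbox convex_Int convex_box)
next
  fix u v x
  assume uv: "u \<in> unit_cube p" "v \<in> unit_cube p"
    and x: "x \<in> unit_cube p \<inter> unit_cube q" "x \<in> open_segment u v"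
  from x(2) obtain t where t: "0 < t" "t < 1" "x = (1 - t) *\<^sub>R u + t *\<^sub>R v"
    by (auto simp: in_segment)
  have "corner q $ j - 1 \<le> u $ j \<and> u $ j \<le> corner q $ j \<and> corner q $ j - 1 \<le> v $ j \<and> v $ j \<le> corner q $ j"
    for j
  proof -
    obtain k l where kl: "corner p $ j = of_int k" "corner q $ j = of_int l"
      using corner_nth_int by metis
    have "of_int k - 1 \<le> u $ j" "u $ j \<le> of_int k" "of_int k - 1 \<le> v $ j" "v $ j \<le> of_int k"
      and "of_int l - 1 \<le> (1 - t) * u $ j + t * v $ j" "(1 - t) * u $ j + t * v $ j \<le> of_int l"
      using uv x(1) by (simp_all add: mem_unit_cube t(3) flip: kl)
    from segment_endpoints_in_unit_interval[OF this(1-4) t(1,2) this(5,6)] kl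
    show ?thesis by simp
  qed
  then have "u \<in> unit_cube q" "v \<in> unit_cube q"
    by (auto simp: mem_unit_cube)
  with uv show "u \<in> unit_cube p \<inter> unit_cube q" "v \<in> unit_cube p \<inter> unit_cube q"
    by auto
qed

text \<open>\<open>BlockA\<close>, \<open>BlockD\<close>, \<open>BlockC\<close>,
  \<open>BlockB\<close> require the maximum to be attained at z, w, x, y respectively; ties go to
  the first of these in the order z, w, x, y.\<close>

lemma labels_disjoint: "X \<noteq> Y \<Longrightarrow> labels n X \<inter> labels n Y = {}"
  by (cases X; cases Y) auto

text \<open>The same distinction is exhaustive. The layer index \<open>i\<close> is the maximal
  coordinate, lowered by one when that is x or y. Only \<open>BlockC\<close> demands more, namely
  \<open>y \<ge> 2\<close>, and \<open>V_labels\<close> removes exactly the failures.\<close>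

lemma R3_labels_cases:
  assumes "p \<in> R3_labels n - V_labels n"
  shows "\<exists>X. p \<in> labels n X"
proof (cases p)
  case (fields x y z w)
  have V: "y = 1 \<Longrightarrow> x \<in> {2..n + 1} \<Longrightarrow> z \<in> {1..x - 1} \<Longrightarrow> w \<notin> {1..x - 1}"
    using assms fields by (auto simp: V_labels_def dest!: spec[of _ "x - 1"])
  have R: "x \<in> {1..n + 1}" "y \<in> {1..n + 1}" "z \<in> {1..n}" "w \<in> {1..n}"
    using assms fields by (auto simp: R3_labels_def)
  consider "x \<le> z" "y \<le> z" "w \<le> z" | "x < y" "z < y" "w < y"
    | "y \<le> x" "z < x" "w < x" | "x \<le> w" "y \<le> w" "z < w"
    by linarith
  then show ?thesis
  proof cases
    case 1
    then have "p \<in> labels n BlockA" using R fields by auto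
    then show ?thesis ..
  next
    case 2
    then have "p \<in> labels n BlockB" using R fields by (auto intro!: bexI[of _ "y - 1"])
    then show ?thesis ..
  next
    case 3
    \<comment> \<open>Here \<open>x \<ge> 2\<close> since \<open>z \<ge> 1\<close>, so
      \<open>y = 1\<close> would put the label into layer \<open>x - 1\<close> of
      \<open>V_labels\<close>.\<close>
    then have "y \<noteq> 1" using R V by auto
    then have "y \<ge> 2" using R by auto
    with 3 have "p \<in> labels n BlockC" using R fields by (auto intro!: bexI[of _ "x - 1"])
    then show ?thesis ..
  next
    case 4
    then have "p \<in> labels n BlockD" using R fields by auto
    then show ?thesis ..
  qed
qed

text \<open>The x coordinate is strictly largest, which leaves only \<open>BlockC\<close>, and that
  block starts at \<open>y = 2\<close>.\<close>

lemma V_labels_unoccupied: "p \<in> V_labels n \<Longrightarrow> p \<notin> labels n X"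
  by (cases X) (auto simp: V_labels_def)

lemma labels_subset_R3_labels:
  "p \<in> labels n X \<Longrightarrow> p \<notin> overhang_labels n \<Longrightarrow> p \<in> R3_labels n"
  by (cases X; cases p) (auto simp: overhang_labels_def R3_labels_def)

text \<open>Both the vacant locations and the overhang are injective images of the same stack of
  \<open>i\<close> by \<open>i\<close> squares.\<close>

lemma int_card_pyramid:
  fixes n :: int
  assumes "inj_on f (SIGMA i:{1..n}. {1..i} \<times> {1..i})"
  shows "int (card (f ` (SIGMA i:{1..n}. {1..i} \<times> {1..i}))) = (\<Sum>i = 1..n. i\<^sup>2)"
proof -
  have "int (card (f ` (SIGMA i:{1..n}. {1..i} \<times> {1..i}))) = (\<Sum>i = 1..n. int (nat i * nat i))"
    using assms by (simp add: card_image card_cartesian_product)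
  also have "\<dots> = (\<Sum>i = 1..n. i\<^sup>2)"
    \<comment> \<open>Indices start at 1, so \<open>nat\<close> truncates nothing.\<close>
    by (rule sum.cong) (auto simp: power2_eq_square)
  finally show ?thesis .
qed

lemma int_card_V_labels: "int (card (V_labels n)) = (\<Sum>i = 1..n. i\<^sup>2)"
proof -
  have "V_labels n = (\<lambda>(i, z, w). (i + 1, 1, z, w)) ` (SIGMA i:{1..n}. {1..i} \<times> {1..i})"
    by (auto simp: V_labels_def image_iff)
  then show ?thesis
    by (simp only:) (rule int_card_pyramid, auto simp: inj_on_def)
qed

lemma int_card_overhang_labels: "int (card (overhang_labels n)) = (\<Sum>i = 1..n. i\<^sup>2)"
proof -
  \<comment> \<open>Every layer \<open>w = i\<close> of \<open>BlockD\<close> admits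
    \<open>z = 0\<close> because \<open>i \<ge> 1\<close>.\<close>
  have "overhang_labels n = (\<lambda>(i, x, y). (x, y, 0, i)) ` (SIGMA i:{1..n}. {1..i} \<times> {1..i})"
    by (auto simp: overhang_labels_def image_iff)
  then show ?thesis
    by (simp only:) (rule int_card_pyramid, auto simp: inj_on_def)
qed

lemma unit_cube_subset_cubes_union: "p \<in> L \<Longrightarrow> unit_cube p \<subseteq> cubes_union L"
  by (auto simp: cubes_union_def)

text \<open>Claims about labels are paired with geometric ones. Vacancy and lying outside are stated
  for the interior of a cube, since its boundary may touch occupied cubes.\<close>

theorem theorem7:
  fixes n :: int
  assumes "n \<ge> 2"
  shows
    "(\<forall>X Y. X \<noteq> Y \<longrightarrow>
        labels n X \<inter> labels n Y = {} \<and>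
        block n X \<inter> block n Y \<subseteq> frontier (block n X) \<inter> frontier (block n Y) \<and>
        (\<forall>p\<in>labels n X. \<forall>q\<in>labels n Y.
           (unit_cube p \<inter> unit_cube q) face_of unit_cube p \<and>
           (unit_cube p \<inter> unit_cube q) face_of unit_cube q))
     \<and>
     (V_labels n \<subseteq> R3_labels n \<and>
      (\<forall>p\<in>R3_labels n - V_labels n.
         (\<exists>X. p \<in> labels n X) \<and> unit_cube p \<subseteq> (\<Union>X. block n X)) \<and>
      (\<forall>p\<in>V_labels n.
         (\<nexists>X. p \<in> labels n X) \<and> interior (unit_cube p) \<inter> (\<Union>X. block n X) = {}) \<and>
      int (card (V_labels n)) = (\<Sum>i = 1..n. i\<^sup>2) \<and>
      (\<forall>x z w. (x, 1, z, w) \<in> V_labels n \<longrightarrow> (x, 2, z, w) \<in> labels n BlockC) \<and>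
      (\<forall>x z w. (x, 2, z, w) \<in> labels n BlockC \<longrightarrow> (x, 1, z, w) \<in> V_labels n))
     \<and>
     ((\<forall>X. \<forall>p\<in>labels n X. p \<notin> overhang_labels n \<longrightarrow>
         p \<in> R3_labels n \<and> unit_cube p \<subseteq> R3 n) \<and>
      (\<forall>p\<in>overhang_labels n.
         p \<notin> R3_labels n \<and> interior (unit_cube p) \<inter> R3 n = {}) \<and>
      int (card (overhang_labels n)) = (\<Sum>i = 1..n. i\<^sup>2))"
proof (intro conjI allI ballI impI)
  fix X Y :: block_name
  assume "X \<noteq> Y"
  then show "labels n X \<inter> labels n Y = {}"
    by (rule labels_disjoint)
  then show "block n X \<inter> block n Y \<subseteq> frontier (block n X) \<inter> frontier (block n Y)"
    unfolding block_def by (rule cubes_union_Int_subset_frontier)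
next
  fix p q
  show "(unit_cube p \<inter> unit_cube q) face_of unit_cube p"
    by (rule unit_cube_Int_face_of)
  show "(unit_cube p \<inter> unit_cube q) face_of unit_cube q"
    using unit_cube_Int_face_of[of q p] by (simp add: Int_commute)
next
  show "V_labels n \<subseteq> R3_labels n"
    by (auto simp: V_labels_def R3_labels_def)
next
  fix p
  assume p: "p \<in> R3_labels n - V_labels n"
  then show "\<exists>X. p \<in> labels n X"
    by (rule R3_labels_cases)
  then show "unit_cube p \<subseteq> (\<Union>X. block n X)"
    using unit_cube_subset_cubes_union unfolding block_def by blast
next
  fix p
  assume "p \<in> V_labels n"
  then have "p \<notin> labels n X" for X
    by (rule V_labels_unoccupied)
  then show "\<nexists>X. p \<in> labels n X" "interior (unit_cube p) \<inter> (\<Union>X. block n X) = {}"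
    using interior_unit_cube_Int_cubes_union unfolding block_def by blast+
next
  fix x z w
  show "(x, 2, z, w) \<in> labels n BlockC" if "(x, 1, z, w) \<in> V_labels n"
    using that by (auto simp: V_labels_def)
  show "(x, 1, z, w) \<in> V_labels n" if "(x, 2, z, w) \<in> labels n BlockC"
    using that by (auto simp: V_labels_def)
next
  fix X p
  assume "p \<in> labels n X" "p \<notin> overhang_labels n"
  then show "p \<in> R3_labels n"
    by (rule labels_subset_R3_labels)
  then show "unit_cube p \<subseteq> R3 n"
    unfolding R3_def by (rule unit_cube_subset_cubes_union)
next
  fix p
  assume "p \<in> overhang_labels n"
  then show "p \<notin> R3_labels n"
    by (auto simp: overhang_labels_def R3_labels_def)
  then show "interior (unit_cube p) \<inter> R3 n = {}"
    unfolding R3_def by (rule interior_unit_cube_Int_cubes_union)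
\<comment> \<open>The two cardinalities are the goals still open.\<close>
qed (rule int_card_V_labels int_card_overhang_labels)+

end
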